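(* Let $\theta$ be an inner function with $\theta^*=\theta$ and $\theta_0=0$, and let $\phi,\psi\in L^\infty\cap Z_\theta$. Then the operator $T=\mathcal{H}_\phi^\theta\mathcal{H}_\psi^\theta$ satisfies the Brown–Halmos Toeplitz identity on $K_\theta^\perp$, that is, $$U_\theta^*\,\mathcal{H}_\phi^\theta\mathcal{H}_\psi^\theta\,U_\theta=\mathcal{H}_\phi^\theta\mathcal{H}_\psi^\theta,$$ if and only if either $\phi=0$ or $\psi=0$.
   Context: $\mathbb{T}$ is the unit circle with normalized Lebesgue measure, $L^2=L^2(\mathbb{T})$, $L^\infty=L^\infty(\mathbb{T})$. $H^2\subset L^2$ is the Hardy space (functions whose negative Fourier coefficients vanish), $H_0^2=zH^2$, $\overline{H_0^2}=L^2\ominus H^2$. $P:L^2\to H^2$ is the orthogonal projection and $Q=I-P$ is the orthogonal projection onto $\overline{H_0^2}$. The flip $J$ on $L^2$ is $(Jf)(z)=f(\bar z)$, $z\in\mathbb{T}$; $f^*(z)=\overline{f(\bar z)}$. For an inner function $\theta$ (bounded analytic on the disk, unimodular a.e. on $\mathbb{T}$), $\theta_0$ is its $0$-th Fourier coefficient, $K_\theta=H^2\ominus\theta H^2$ and $K_\theta^\perp=L^2\ominus K_\theta=\overline{H_0^2}\oplus\theta H^2$; $Q_\theta=Q+\theta P\bar\theta$ is the orthogonal projection of $L^2$ onto $K_\theta^\perp$. For $\phi\in L^\infty$ the dual truncated Hankel operator is $\mathcal{H}_\phi^\theta:K_\theta^\perp\to K_\theta^\perp$, $\mathcal{H}_\phi^\theta(h)=Q_\theta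 J(\phi h)$. The compressed shift on $K_\theta^\perp$ is $U_\theta h=Q_\theta(zh)$. Also $Z_\theta=\left\{\frac{dz+\tilde h}{1-\bar\theta_0\theta}:\tilde h\in J(K_\theta),\,d\in\mathbb{C}\right\}$. *)

theory Defs
  imports "HOL-Complex_Analysis.Complex_Analysis"
begin

text \<open>
  Normalized Lebesgue measure on the unit circle, parametrized by \<open>cis\<close> on \<open>[-pi, pi]\<close>;
  the interval is chosen symmetric so that conjugation corresponds to \<open>t \<mapsto> -t\<close>.
\<close>

definition circle_measure :: "complex measure" where
  "circle_measure =
     distr (uniform_measure lborel {-pi..pi}) (restrict_space borel (sphere 0 1)) cis"

lemma sets_circle_measure [measurable_cong]:
  "sets circle_measure = sets (restrict_space borel (sphere 0 1))"
  by (simp add: circle_measure_def)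

lemma space_circle_measure [simp]: "space circle_measure = sphere 0 1"
  by (simp add: circle_measure_def space_restrict_space)

lemma measurable_cis_circle:
  "cis \<in> uniform_measure lborel {-pi..pi} \<rightarrow>\<^sub>M restrict_space borel (sphere 0 1)"
proof -
  have "cis \<in> borel_measurable borel"
    by (intro borel_measurable_continuous_onI continuous_intros)
  then have "cis \<in> uniform_measure lborel {-pi..pi} \<rightarrow>\<^sub>M borel"
    by simp
  then show ?thesis
    by (intro measurable_restrict_space2) auto
qed

lemma borel_measurable_circle:
  "f \<in> borel_measurable borel \<Longrightarrow> f \<in> borel_measurable circle_measure"
  by (simp add: circle_measure_def measurable_restrict_space1)

lemma measurable_cnj_circle: "cnj \<in> circle_measure \<rightarrow>\<^sub>M circle_measure"
proof -
  have "cnj \<in> circle_measure \<rightarrow>\<^sub>M borel"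
    by (intro borel_measurable_circle borel_measurable_continuous_onI continuous_intros)
  then have "cnj \<in> circle_measure \<rightarrow>\<^sub>M restrict_space borel (sphere 0 1)"
    by (intro measurable_restrict_space2) auto
  then show ?thesis
    by (simp add: measurable_def sets_circle_measure space_restrict_space)
qed

lemma distr_uniform_uminus:
  "distr (uniform_measure lborel {-pi..pi}) borel uminus = uniform_measure lborel {-pi..pi}"
    (is "distr ?U _ _ = _")
proof (rule measure_eqI)
  fix A :: "real set" assume "A \<in> sets (distr ?U borel uminus)"
  then have A: "A \<in> sets borel" by simp
  then have A': "uminus -` A \<in> sets borel"
    using measurable_sets[of uminus borel borel A] by (simp)
  have eq: "{-pi..pi} \<inter> uminus -` A = uminus -` ({-pi..pi} \<inter> A)" by auto
  have "emeasure lborel (uminus -` ({-pi..pi} \<inter> A))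
      = emeasure (distr lborel borel uminus) ({-pi..pi} \<inter> A)"
    using A by (subst emeasure_distr) auto
  also have "\<dots> = emeasure lborel ({-pi..pi} \<inter> A)"
    by (simp add: lborel_distr_uminus)
  finally have "emeasure lborel ({-pi..pi} \<inter> uminus -` A) = emeasure lborel ({-pi..pi} \<inter> A)"
    by (simp only: eq)
  then show "emeasure (distr ?U borel uminus) A = emeasure ?U A"
    using A A' by (subst emeasure_distr) auto
qed simp

lemma distr_circle_cnj: "distr circle_measure circle_measure cnj = circle_measure"
proof -
  let ?U = "uniform_measure lborel {-pi..pi}"
  let ?R = "restrict_space borel (sphere 0 (1::real)) :: complex measure"
  have R: "sets circle_measure = sets ?R" by (rule sets_circle_measure)
  have c: "cnj \<in> ?R \<rightarrow>\<^sub>M ?R"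
    using measurable_cnj_circle measurable_cong_sets[OF R R] by simp
  have "distr circle_measure circle_measure cnj = distr (distr ?U ?R cis) ?R cnj"
    by (intro distr_cong) (simp_all add: R circle_measure_def)
  also have "\<dots> = distr ?U ?R (cnj \<circ> cis)"
    by (rule distr_distr[OF c measurable_cis_circle])
  also have "cnj \<circ> cis = cis \<circ> uminus"
    by (auto simp: fun_eq_iff cis_cnj)
  also have "distr ?U ?R (cis \<circ> uminus) = distr (distr ?U borel uminus) ?R cis"
  proof (rule distr_distr[symmetric])
    show "cis \<in> borel \<rightarrow>\<^sub>M ?R"
      using measurable_cis_circle by (simp add: measurable_def)
    show "uminus \<in> ?U \<rightarrow>\<^sub>M borel"
      by simp
  qed
  also have "\<dots> = circle_measure"
    by (simp add: distr_uniform_uminus circle_measure_def)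
  finally show ?thesis .
qed

lemma AE_circle_cnj:
  assumes "AE z in circle_measure. P z"
  shows "AE z in circle_measure. P (cnj z)"
proof -
  have "AE z in distr circle_measure circle_measure cnj. P z"
    using assms by (simp only: distr_circle_cnj)
  then show ?thesis
    by (rule AE_distrD[OF measurable_cnj_circle])
qed


lemma borel_measurable_cnj_comp:
  assumes "f \<in> borel_measurable M"
  shows "(\<lambda>z. cnj (f z)) \<in> borel_measurable M"
  by (rule measurable_compose[OF assms borel_measurable_continuous_onI]) (intro continuous_intros)


text \<open>
  Measurable functions on the circle modulo equality almost everywhere.  The spaces
  \<open>L\<^sup>2\<close> and \<open>L\<^sup>\<infinity>\<close> are subsets of this type, so products such as \<open>\<phi> h\<close> with
  \<open>\<phi> \<in> L\<^sup>\<infinity>\<close>, \<open>h \<in> L\<^sup>2\<close> are ordinary ring products, and equality in the type is equality a.e.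
\<close>

definition circle_ae_eq :: "(complex \<Rightarrow> complex) \<Rightarrow> (complex \<Rightarrow> complex) \<Rightarrow> bool" where
  "circle_ae_eq f g \<longleftrightarrow>
     f \<in> borel_measurable circle_measure \<and> g \<in> borel_measurable circle_measure \<and>
     (AE z in circle_measure. f z = g z)"

lemma circle_ae_eq_AE_iff:
  assumes "circle_ae_eq f f'"
  shows "(AE z in circle_measure. R z (f z)) \<longleftrightarrow> (AE z in circle_measure. R z (f' z))"
proof (rule eventually_subst)
  show "AE z in circle_measure. R z (f z) = R z (f' z)"
    using assms by (auto simp: circle_ae_eq_def elim: eventually_mono)
qed

quotient_type circle_fun = "complex \<Rightarrow> complex" / partial: circle_ae_eq
proof (rule part_equivpI)
  show "\<exists>f. circle_ae_eq f f"
    by (auto simp: circle_ae_eq_def intro!: exI[of _ "\<lambda>_. 0"])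
  show "symp circle_ae_eq"
    by (auto simp: symp_def circle_ae_eq_def elim: eventually_mono)
  show "transp circle_ae_eq"
    unfolding transp_def circle_ae_eq_def by (auto elim: eventually_elim2)
qed

lift_definition const_fun :: "complex \<Rightarrow> circle_fun" is "\<lambda>c _. c"
  by (simp add: circle_ae_eq_def)

lift_definition coord_fun :: circle_fun is "\<lambda>z. z"
  by (simp add: circle_ae_eq_def borel_measurable_circle)

lift_definition conj_fun :: "circle_fun \<Rightarrow> circle_fun" is "\<lambda>f z. cnj (f z)"
  by (simp add: circle_ae_eq_def borel_measurable_cnj_comp)

lift_definition flip :: "circle_fun \<Rightarrow> circle_fun" is "\<lambda>f z. f (cnj z)"
  unfolding circle_ae_eq_def
  by (intro conjI measurable_compose[OF measurable_cnj_circle] AE_circle_cnj) auto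

instantiation circle_fun :: "{comm_ring_1, inverse}"
begin

lift_definition zero_circle_fun :: circle_fun is "\<lambda>_. 0"
  by (simp add: circle_ae_eq_def)

lift_definition one_circle_fun :: circle_fun is "\<lambda>_. 1"
  by (simp add: circle_ae_eq_def)

lift_definition plus_circle_fun :: "circle_fun \<Rightarrow> circle_fun \<Rightarrow> circle_fun" is "\<lambda>f g z. f z + g z"
  by (auto simp: circle_ae_eq_def)

lift_definition minus_circle_fun :: "circle_fun \<Rightarrow> circle_fun \<Rightarrow> circle_fun" is "\<lambda>f g z. f z - g z"
  by (auto simp: circle_ae_eq_def)

lift_definition uminus_circle_fun :: "circle_fun \<Rightarrow> circle_fun" is "\<lambda>f z. - f z"
  by (auto simp: circle_ae_eq_def)

lift_definition times_circle_fun :: "circle_fun \<Rightarrow> circle_fun \<Rightarrow> circle_fun" is "\<lambda>f g z. f z * g z"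
  by (auto simp: circle_ae_eq_def)

lift_definition divide_circle_fun :: "circle_fun \<Rightarrow> circle_fun \<Rightarrow> circle_fun" is "\<lambda>f g z. f z / g z"
  by (auto simp: circle_ae_eq_def)

lift_definition inverse_circle_fun :: "circle_fun \<Rightarrow> circle_fun" is "\<lambda>f z. inverse (f z)"
  by (auto simp: circle_ae_eq_def)

lemma circle_measure_nontrivial: "\<not> (AE z in circle_measure. False)"
proof
  assume "AE z in circle_measure. False"
  then have "AE t in uniform_measure lborel {-pi..pi}. False"
    unfolding circle_measure_def by (rule AE_distrD[OF measurable_cis_circle])
  then have "AE t in lborel. t \<notin> {-pi..pi}"
    by (subst (asm) AE_uniform_measure) auto
  then have "emeasure lborel {-pi..pi} = 0"
    by (subst (asm) AE_iff_measurable[where N = "{-pi..pi}"]) auto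
  then show False
    using pi_gt_zero by simp
qed

instance
proof
  show "(0 :: circle_fun) \<noteq> 1"
    by transfer (simp add: circle_ae_eq_def circle_measure_nontrivial)
qed (transfer; auto simp: circle_ae_eq_def algebra_simps)+

end


text \<open>
  The \<open>L\<^sup>2\<close> inner product, linear in the first argument.
\<close>

lift_definition ip :: "circle_fun \<Rightarrow> circle_fun \<Rightarrow> complex"
  is "\<lambda>f g. LINT z|circle_measure. f z * cnj (g z)"
proof -
  fix f f' g g' assume "circle_ae_eq f f'" "circle_ae_eq g g'"
  then have m: "f \<in> borel_measurable circle_measure" "f' \<in> borel_measurable circle_measure"
      "g \<in> borel_measurable circle_measure" "g' \<in> borel_measurable circle_measure"
    and "AE z in circle_measure. f z = f' z" "AE z in circle_measure. g z = g' z"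
    by (auto simp: circle_ae_eq_def)
  then have ae: "AE z in circle_measure. f z * cnj (g z) = f' z * cnj (g' z)"
    by (auto elim: eventually_elim2)
  show "(LINT z|circle_measure. f z * cnj (g z)) = (LINT z|circle_measure. f' z * cnj (g' z))"
    using m ae by (intro integral_cong_AE borel_measurable_times borel_measurable_cnj_comp)
qed

lift_definition fourier_coeff :: "circle_fun \<Rightarrow> int \<Rightarrow> complex"
  is "\<lambda>f n. LINT z|circle_measure. f z * z powi (- n)"
proof (rule ext)
  fix f f' :: "complex \<Rightarrow> complex" and n :: int
  assume "circle_ae_eq f f'"
  moreover have "(\<lambda>z::complex. z powi (- n)) \<in> borel_measurable circle_measure"
    by (intro borel_measurable_circle) (simp add: power_int_def)
  ultimately show "(LINT z|circle_measure. f z * z powi (- n)) = (LINT z|circle_measure. f' z * z powi (- n))"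
    by (intro integral_cong_AE borel_measurable_times) (auto simp: circle_ae_eq_def elim: eventually_mono)
qed

lift_definition square_integrable :: "circle_fun \<Rightarrow> bool"
  is "\<lambda>f. integrable circle_measure (\<lambda>z. (cmod (f z))\<^sup>2)"
  by (intro integrable_cong_AE) (auto simp: circle_ae_eq_def elim: eventually_mono)

lift_definition ess_bounded :: "circle_fun \<Rightarrow> bool"
  is "\<lambda>f. \<exists>C. AE z in circle_measure. cmod (f z) \<le> C"
  by (rule arg_cong[where f = Ex], rule ext, erule circle_ae_eq_AE_iff)

text \<open>
  An inner function, given by its boundary values \<open>f\<close> on the circle: these are the radial limits
  (almost everywhere) of a bounded holomorphic function on the disk, and they are unimodular.
\<close>

lift_definition inner_fun :: "circle_fun \<Rightarrow> bool"
  is "\<lambda>f. (\<exists>F. F holomorphic_on ball 0 1 \<and> bounded (F ` ball 0 1) \<and>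
            (AE z in circle_measure. ((\<lambda>r. F (of_real r * z)) \<longlongrightarrow> f z) (at_left 1))) \<and>
          (AE z in circle_measure. cmod (f z) = 1)"
proof -
  fix f f' assume eq: "circle_ae_eq f f'"
  note circle_ae_eq_AE_iff[OF eq, where R = "\<lambda>z w. ((\<lambda>r. F (of_real r * z)) \<longlongrightarrow> w) (at_left 1)" for F]
    and circle_ae_eq_AE_iff[OF eq, where R = "\<lambda>z w. cmod w = 1"]
  then show "((\<exists>F. F holomorphic_on ball 0 1 \<and> bounded (F ` ball 0 1) \<and>
            (AE z in circle_measure. ((\<lambda>r. F (of_real r * z)) \<longlongrightarrow> f z) (at_left 1))) \<and>
          (AE z in circle_measure. cmod (f z) = 1)) =
        ((\<exists>F. F holomorphic_on ball 0 1 \<and> bounded (F ` ball 0 1) \<and>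
            (AE z in circle_measure. ((\<lambda>r. F (of_real r * z)) \<longlongrightarrow> f' z) (at_left 1))) \<and>
          (AE z in circle_measure. cmod (f' z) = 1))"
    by (simp only:)
qed

definition L2 :: "circle_fun set" where
  "L2 = {f. square_integrable f}"

definition Linf :: "circle_fun set" where
  "Linf = {f. ess_bounded f}"

definition H2 :: "circle_fun set" where
  "H2 = {f \<in> L2. \<forall>n<0. fourier_coeff f n = 0}"

definition ominus :: "circle_fun set \<Rightarrow> circle_fun set \<Rightarrow> circle_fun set"  (infixl "\<ominus>\<^sub>\<perp>" 65) where
  "A \<ominus>\<^sub>\<perp> B = {f \<in> A. \<forall>g\<in>B. ip f g = 0}"

text \<open>
  Orthogonal projection of \<open>L\<^sup>2\<close> onto a closed subspace \<open>S\<close>, and the Hilbert space adjoint of a bounded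
  operator \<open>S \<rightarrow> S\<close>.  Operators are total functions on the type; the values are meaningful only
  for arguments in \<open>L\<^sup>2\<close> and \<open>S\<close>, respectively.
\<close>

definition orth_proj :: "circle_fun set \<Rightarrow> circle_fun \<Rightarrow> circle_fun" where
  "orth_proj S f = (THE g. g \<in> S \<and> (\<forall>h\<in>S. ip (f - g) h = 0))"

definition adjoint_on :: "circle_fun set \<Rightarrow> (circle_fun \<Rightarrow> circle_fun) \<Rightarrow> circle_fun \<Rightarrow> circle_fun" where
  "adjoint_on S A g = (THE k. k \<in> S \<and> (\<forall>h\<in>S. ip (A h) g = ip h k))"

definition riesz_proj :: "circle_fun \<Rightarrow> circle_fun" where
  "riesz_proj = orth_proj H2"

definition riesz_coproj :: "circle_fun \<Rightarrow> circle_fun" where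
  "riesz_coproj f = f - riesz_proj f"

definition star_fun :: "circle_fun \<Rightarrow> circle_fun" where
  "star_fun f = conj_fun (flip f)"

definition model_space :: "circle_fun \<Rightarrow> circle_fun set" where
  "model_space \<theta> = H2 \<ominus>\<^sub>\<perp> ((\<lambda>f. \<theta> * f) ` H2)"

definition model_perp :: "circle_fun \<Rightarrow> circle_fun set" where
  "model_perp \<theta> = L2 \<ominus>\<^sub>\<perp> model_space \<theta>"

definition model_perp_proj :: "circle_fun \<Rightarrow> circle_fun \<Rightarrow> circle_fun" where
  "model_perp_proj \<theta> f = riesz_coproj f + \<theta> * riesz_proj (conj_fun \<theta> * f)"

definition dual_trunc_Hankel :: "circle_fun \<Rightarrow> circle_fun \<Rightarrow> circle_fun \<Rightarrow> circle_fun" where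
  "dual_trunc_Hankel \<theta> \<phi> h = model_perp_proj \<theta> (flip (\<phi> * h))"

definition compressed_shift :: "circle_fun \<Rightarrow> circle_fun \<Rightarrow> circle_fun" where
  "compressed_shift \<theta> h = model_perp_proj \<theta> (coord_fun * h)"

text \<open>The quotient is the pointwise one, taken almost everywhere.\<close>

definition Z_space :: "circle_fun \<Rightarrow> circle_fun set" where
  "Z_space \<theta> = {(const_fun d * coord_fun + h) / (1 - const_fun (cnj (fourier_coeff \<theta> 0)) * \<theta>) | d h.
           h \<in> flip ` model_space \<theta>}"

end

theory Submission
  imports Defs
begin

text \<open>
  If a symbol is zero, both sides of the identity vanish.  For the converse, recall that the
  complement of the model space is the direct sum of \<open>L\<^sup>2 \<ominus>\<^sub>\<perp> H\<^sup>2\<close>, the closed span of the powers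
  \<open>z_bar ^ n\<close> with \<open>n \<ge> 1\<close>, and \<open>\<theta> H\<^sup>2\<close>.  Because \<open>\<theta>\<^sub>0 = 0\<close>, the constant \<open>1\<close> lies in the
  model space, so the compressed shift \<open>U\<close> maps \<open>z_bar\<close> to \<open>0\<close> and otherwise lowers the exponent of
  \<open>z_bar ^ n\<close> by one.  If an operator \<open>T\<close> satisfies \<open>U\<^sup>* T U = T\<close>, then \<open>T z_bar = U\<^sup>* T 0 = 0\<close>, and
  by induction \<open>T\<close> annihilates every \<open>z_bar ^ n\<close> (\<open>Toeplitz_identity_vanishes\<close>).

  It remains to see that a product \<open>T\<close> of two dual truncated Hankel operators with nonzero symbols
  \<open>\<phi>\<close> and \<open>\<psi>\<close> cannot do this.  Also because \<open>\<theta>\<^sub>0 = 0\<close>, a symbol in the space \<open>Z\<close> is just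
  \<open>d z + J f\<close> with \<open>f\<close> in the model space, which makes \<open>w\<^sub>\<phi> = J(\<phi> \<theta>)\<close> orthogonal to \<open>H\<^sup>2\<close>
  (\<open>Z_space_symbol\<close>).  Consequently the operator with symbol \<open>\<phi>\<close> sends \<open>\<theta>\<close> to \<open>w\<^sub>\<phi>\<close>, and the
  one with symbol \<open>\<psi>\<close> sends \<open>z_bar ^ n\<close> to \<open>\<theta> P(z ^ n w\<^sub>\<psi>)\<close>.  Let \<open>- n\<close> be the largest index of a
  nonzero Fourier coefficient \<open>c\<close> of \<open>w\<^sub>\<psi>\<close>.  Then \<open>P(z ^ n w\<^sub>\<psi>) = c\<close>, hence
  \<open>T (z_bar ^ n) = c w\<^sub>\<phi>\<close>, which is not zero (\<open>dual_trunc_Hankel_product_nonzero\<close>).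

  The analytic input is that multiplication by \<open>\<theta>\<close>, given by the radial limits of a bounded
  holomorphic function, maps \<open>H\<^sup>2\<close>, defined by Fourier coefficients, into itself
  (\<open>inner_mult_H2\<close>).
\<close>

section \<open>Integration on the circle\<close>

lemma emeasure_circle: "emeasure circle_measure (sphere 0 1) = 1"
proof -
  have "cis -` sphere 0 1 = UNIV"
    by auto
  then have "emeasure circle_measure (sphere 0 1) =
      emeasure (uniform_measure lborel {-pi..pi}) (space (uniform_measure lborel {-pi..pi}))"
    unfolding circle_measure_def
    by (subst emeasure_distr[OF measurable_cis_circle]) (auto simp: sets_restrict_space)
  also have "\<dots> = 1"
    using pi_gt_zero by (simp add: emeasure_uniform_measure ennreal_divide_self)
  finally show ?thesis .
qed

interpretation circle: finite_measure circle_measure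
  by standard (simp add: emeasure_circle)

lemma measure_circle: "measure circle_measure (sphere 0 1) = 1"
  by (simp add: measure_def emeasure_circle)

lemma measurable_circle_continuous:
  assumes "continuous_on (sphere 0 1) u"
  shows "u \<in> borel_measurable circle_measure"
  using borel_measurable_continuous_on_restrict[OF assms]
  by (simp add: measurable_cong_sets[OF sets_circle_measure refl])

lemma integrable_mult_continuous_circle:
  fixes f :: "complex \<Rightarrow> complex"
  assumes "integrable circle_measure f" "continuous_on (sphere 0 1) u"
  shows "integrable circle_measure (\<lambda>z. u z * f z)"
proof -
  have "compact (u ` sphere 0 1)"
    using assms(2) by (intro compact_continuous_image) auto
  then obtain C where C: "\<And>z. z \<in> sphere 0 1 \<Longrightarrow> cmod (u z) \<le> C"
    by (metis bounded_iff compact_imp_bounded image_eqI)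
  have meas: "(\<lambda>z. u z * f z) \<in> borel_measurable circle_measure"
    using assms measurable_circle_continuous by (intro borel_measurable_times) auto
  show ?thesis
  proof (rule Bochner_Integration.integrable_bound)
    show "integrable circle_measure (\<lambda>z. C * cmod (f z))"
      using assms(1) by simp
    show "AE z in circle_measure. cmod (u z * f z) \<le> norm (C * cmod (f z))"
    proof (rule AE_I2)
      fix z assume "z \<in> space circle_measure"
      then have "cmod (u z) \<le> C"
        using C by simp
      then have "cmod (u z * f z) \<le> C * cmod (f z)"
        by (simp add: norm_mult mult_right_mono)
      then show "cmod (u z * f z) \<le> norm (C * cmod (f z))"
        by simp
    qed
  qed (rule meas)
qed

lemma integral_circle:
  fixes u :: "complex \<Rightarrow> complex"
  assumes "continuous_on (sphere 0 1) u"
  shows "(LINT z|circle_measure. u z) = (LINT t:{-pi..pi}|lborel. u (cis t)) /\<^sub>R (2 * pi)"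
proof -
  have u: "u \<in> borel_measurable (restrict_space borel (sphere 0 1))"
    by (rule borel_measurable_continuous_on_restrict[OF assms])
  have "continuous_on UNIV (u \<circ> cis)"
    by (intro continuous_on_compose continuous_intros continuous_on_subset[OF assms]) auto
  then have meas: "(\<lambda>t. u (cis t)) \<in> borel_measurable borel"
    by (simp add: borel_measurable_continuous_onI o_def)
  have dens: "uniform_measure lborel {-pi..pi} = density lborel (\<lambda>t. ennreal (indicator {-pi..pi} t / (2 * pi)))"
    unfolding uniform_measure_def
    by (rule density_cong) (auto simp: divide_ennreal ennreal_indicator[symmetric] split: split_indicator)
  have "(LINT z|circle_measure. u z) = (LINT t|uniform_measure lborel {-pi..pi}. u (cis t))"
    unfolding circle_measure_def by (rule integral_distr[OF measurable_cis_circle u])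
  also have "\<dots> = (LINT t|lborel. (indicator {-pi..pi} t / (2 * pi)) *\<^sub>R u (cis t))"
    unfolding dens by (rule integral_density) (use meas in auto)
  also have "\<dots> = (LINT t|lborel. (indicator {-pi..pi} t *\<^sub>R u (cis t)) /\<^sub>R (2 * pi))"
    by (simp only: scaleR_scaleR divide_inverse mult.commute)
  also have "\<dots> = (LINT t:{-pi..pi}|lborel. u (cis t)) /\<^sub>R (2 * pi)"
    unfolding set_lebesgue_integral_def by (rule Bochner_Integration.integral_scaleR_right)
  finally show ?thesis .
qed

lemma integral_circle_power: "(LINT z|circle_measure. z ^ Suc n) = 0"
proof -
  define a where "a = real (Suc n)"
  have "a \<noteq> 0"
    by (simp add: a_def)
  have "(LINT t:{-pi..pi}|lborel. cis (a * t)) = cis (a * pi) / (\<i> * a) - cis (a * (-pi)) / (\<i> * a)"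
    unfolding set_lebesgue_integral_def
  proof (rule integral_FTC_Icc)
    show "((\<lambda>t. cis (a * t) / (\<i> * a)) has_vector_derivative cis (a * t)) (at t within {-pi..pi})" for t
    proof -
      have "((\<lambda>t. exp (\<i> * (a * t)) / (\<i> * a)) has_field_derivative exp (\<i> * (a * complex_of_real t)))
          (at (complex_of_real t) within S)" for S
        using \<open>a \<noteq> 0\<close> by (auto intro!: derivative_eq_intros simp: mult_ac)
      then have "((\<lambda>t. exp (\<i> * (a * complex_of_real t)) / (\<i> * a)) has_vector_derivative
          exp (\<i> * (a * complex_of_real t))) (at t within {-pi..pi})"
        by (intro has_vector_derivative_real_field) blast
      then show ?thesis
        by (simp add: cis_conv_exp)
    qed
    show "continuous_on {-pi..pi} (\<lambda>t. cis (a * t))"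
      by (intro continuous_intros)
  qed simp
  also have "cis (a * (-pi)) = cis (a * pi)"
    by (simp add: a_def complex_eq_iff sin_npi del: of_nat_Suc)
  finally have "(LINT t:{-pi..pi}|lborel. cis (a * t)) = 0"
    by simp
  moreover have "cis t ^ Suc n = cis (a * t)" for t
    by (simp only: a_def Complex.DeMoivre)
  ultimately show ?thesis
    by (subst integral_circle) (auto intro!: continuous_intros simp del: power_Suc)
qed

section \<open>The algebra of functions on the circle\<close>

abbreviation z_bar :: circle_fun where
  "z_bar \<equiv> conj_fun coord_fun"

lemma const_fun_zero: "const_fun 0 = 0"
  by transfer (simp add: circle_ae_eq_def)

lemma const_fun_one: "const_fun 1 = 1"
  by transfer (simp add: circle_ae_eq_def)

lemma const_fun_mult: "const_fun (a * b) = const_fun a * const_fun b"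
  by transfer (simp add: circle_ae_eq_def)

lemma conj_fun_mult: "conj_fun (f * g) = conj_fun f * conj_fun g"
  by transfer (auto simp: circle_ae_eq_def intro!: borel_measurable_times borel_measurable_cnj_comp)

lemma conj_fun_conj_fun: "conj_fun (conj_fun f) = f"
  by transfer (simp add: circle_ae_eq_def borel_measurable_cnj_comp)

lemma conj_fun_one: "conj_fun 1 = 1"
  by transfer (simp add: circle_ae_eq_def)

lemma conj_fun_power: "conj_fun (f ^ n) = conj_fun f ^ n"
  by (induction n) (simp_all add: conj_fun_one conj_fun_mult)

lemma flip_add: "flip (f + g) = flip f + flip g"
  by transfer (auto simp: circle_ae_eq_def intro!: borel_measurable_add measurable_compose[OF measurable_cnj_circle])

lemma flip_mult: "flip (f * g) = flip f * flip g"
  by transfer (auto simp: circle_ae_eq_def intro!: borel_measurable_times measurable_compose[OF measurable_cnj_circle])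

lemma flip_flip: "flip (flip f) = f"
  by transfer (auto simp: circle_ae_eq_def)

lemma flip_const: "flip (const_fun c) = const_fun c"
  by transfer (auto simp: circle_ae_eq_def)

lemma flip_zero: "flip 0 = 0"
  using flip_const[of 0] by (simp add: const_fun_zero)

lemma flip_coord: "flip coord_fun = z_bar"
  by transfer (auto simp: circle_ae_eq_def intro!: borel_measurable_cnj_comp borel_measurable_circle)

lemma flip_z_bar: "flip z_bar = coord_fun"
  by (metis flip_coord flip_flip)

lemma flip_power: "flip (f ^ n) = flip f ^ n"
  by (induction n) (simp_all add: flip_mult flip_const[of 1, unfolded const_fun_one])

lemma circle_fun_divide_one: "f / 1 = (f :: circle_fun)"
  by transfer (simp add: circle_ae_eq_def)

lemma z_bar_coord: "z_bar * coord_fun = 1"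
proof transfer
  have "(\<lambda>z. cnj z * z) \<in> borel_measurable circle_measure"
    by (intro measurable_circle_continuous continuous_intros)
  moreover have "cnj z * z = 1" if "z \<in> sphere 0 1" for z
    using that by (simp add: complex_norm_square[symmetric] mult.commute)
  ultimately show "circle_ae_eq (\<lambda>z. cnj z * z) (\<lambda>_. 1)"
    by (auto simp: circle_ae_eq_def intro!: AE_I2)
qed

lemma coord_z_bar_cancel: "coord_fun * (z_bar * f) = f" "z_bar * (coord_fun * f) = f"
  using z_bar_coord by (metis mult.assoc mult.commute mult_1_left)+

section \<open>Square integrable functions and their inner product\<close>

lemma Linf_const: "const_fun c \<in> Linf"
  unfolding Linf_def mem_Collect_eq
proof transfer
  show "\<exists>C. AE z in circle_measure. cmod c \<le> C" for c
    by (rule exI[of _ "cmod c"]) simp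
qed

lemma Linf_coord: "coord_fun \<in> Linf"
  unfolding Linf_def mem_Collect_eq by transfer (auto intro!: exI[of _ 1] AE_I2)

lemma Linf_conj: "f \<in> Linf \<Longrightarrow> conj_fun f \<in> Linf"
  unfolding Linf_def mem_Collect_eq by transfer simp

lemma L2_Linf_mult:
  assumes "u \<in> Linf" "f \<in> L2"
  shows "u * f \<in> L2"
  using assms unfolding L2_def Linf_def mem_Collect_eq
proof transfer
  fix u f :: "complex \<Rightarrow> complex"
  assume "circle_ae_eq u u" "circle_ae_eq f f"
    and bdd: "\<exists>C. AE z in circle_measure. cmod (u z) \<le> C"
    and int: "integrable circle_measure (\<lambda>z. (cmod (f z))\<^sup>2)"
  then have meas: "u \<in> borel_measurable circle_measure" "f \<in> borel_measurable circle_measure"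
    by (auto simp: circle_ae_eq_def)
  obtain C where C: "AE z in circle_measure. cmod (u z) \<le> C"
    using bdd by blast
  show "integrable circle_measure (\<lambda>z. (cmod (u z * f z))\<^sup>2)"
  proof (rule Bochner_Integration.integrable_bound)
    show "integrable circle_measure (\<lambda>z. C\<^sup>2 * (cmod (f z))\<^sup>2)"
      using int by simp
    show "AE z in circle_measure. norm ((cmod (u z * f z))\<^sup>2) \<le> norm (C\<^sup>2 * (cmod (f z))\<^sup>2)"
      using C
    proof eventually_elim
      case (elim z)
      then have "(cmod (u z))\<^sup>2 \<le> C\<^sup>2"
        by (intro power_mono) auto
      then show ?case
        by (simp add: norm_mult power_mult_distrib mult_right_mono)
    qed
  qed (use meas in measurable)
qed

lemma L2_add:
  assumes "f \<in> L2" "g \<in> L2"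
  shows "f + g \<in> L2"
  using assms unfolding L2_def mem_Collect_eq
proof transfer
  fix f g :: "complex \<Rightarrow> complex"
  assume "circle_ae_eq f f" "circle_ae_eq g g"
    and int: "integrable circle_measure (\<lambda>z. (cmod (f z))\<^sup>2)" "integrable circle_measure (\<lambda>z. (cmod (g z))\<^sup>2)"
  then have meas: "f \<in> borel_measurable circle_measure" "g \<in> borel_measurable circle_measure"
    by (auto simp: circle_ae_eq_def)
  show "integrable circle_measure (\<lambda>z. (cmod (f z + g z))\<^sup>2)"
  proof (rule Bochner_Integration.integrable_bound)
    show "integrable circle_measure (\<lambda>z. 2 * ((cmod (f z))\<^sup>2 + (cmod (g z))\<^sup>2))"
      using int by simp
    have "(cmod (a + b))\<^sup>2 \<le> 2 * ((cmod a)\<^sup>2 + (cmod b)\<^sup>2)" for a b :: complex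
    proof -
      have "(cmod (a + b))\<^sup>2 \<le> (cmod a + cmod b)\<^sup>2"
        by (intro power_mono norm_triangle_ineq) simp
      also have "\<dots> \<le> 2 * ((cmod a)\<^sup>2 + (cmod b)\<^sup>2)"
        using sum_squares_bound[of "cmod a" "cmod b"] by (simp add: power2_sum)
      finally show ?thesis .
    qed
    then show "AE z in circle_measure. norm ((cmod (f z + g z))\<^sup>2) \<le> norm (2 * ((cmod (f z))\<^sup>2 + (cmod (g z))\<^sup>2))"
      by simp
  qed (use meas in measurable)
qed

lemma L2_scale: "f \<in> L2 \<Longrightarrow> const_fun c * f \<in> L2"
  by (rule L2_Linf_mult[OF Linf_const])

lemma circle_fun_diff_conv_add: "f - g = f + const_fun (-1) * g"
  by transfer (auto simp: circle_ae_eq_def)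

lemma L2_diff: "f \<in> L2 \<Longrightarrow> g \<in> L2 \<Longrightarrow> f - g \<in> L2"
  unfolding circle_fun_diff_conv_add by (intro L2_add L2_scale)

lemma L2_one: "1 \<in> L2"
  unfolding L2_def mem_Collect_eq by transfer simp

lemma L2_zero: "0 \<in> L2"
  unfolding L2_def mem_Collect_eq by transfer simp

lemma L2_conj: "f \<in> L2 \<Longrightarrow> conj_fun f \<in> L2"
  unfolding L2_def mem_Collect_eq by transfer simp

lemma L2_coord_power_mult: "f \<in> L2 \<Longrightarrow> coord_fun ^ n * f \<in> L2"
  by (induction n) (auto simp: mult.assoc intro: L2_Linf_mult Linf_coord)

lemma L2_z_bar_power: "z_bar ^ n \<in> L2"
  using L2_conj[OF L2_coord_power_mult[OF L2_one]] by (simp add: conj_fun_power)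

lemma integrable_mult_cnj:
  assumes meas: "f \<in> borel_measurable M" "g \<in> borel_measurable M"
    and int: "integrable M (\<lambda>z. (cmod (f z))\<^sup>2)" "integrable M (\<lambda>z. (cmod (g z))\<^sup>2)"
  shows "integrable M (\<lambda>z. f z * cnj (g z))"
proof (rule Bochner_Integration.integrable_bound)
  show "integrable M (\<lambda>z. (cmod (f z))\<^sup>2 + (cmod (g z))\<^sup>2)"
    using int by simp
  have "cmod a * cmod b \<le> (cmod a)\<^sup>2 + (cmod b)\<^sup>2" for a b
  proof -
    have "0 \<le> cmod a * cmod b"
      by simp
    then show ?thesis
      using sum_squares_bound[of "cmod a" "cmod b"] by linarith
  qed
  then show "AE z in M. norm (f z * cnj (g z)) \<le> norm ((cmod (f z))\<^sup>2 + (cmod (g z))\<^sup>2)"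
    by (simp add: norm_mult)
  show "(\<lambda>z. f z * cnj (g z)) \<in> borel_measurable M"
    using meas by (intro borel_measurable_times borel_measurable_cnj_comp)
qed

lemma ip_add_left:
  assumes "f \<in> L2" "g \<in> L2" "h \<in> L2"
  shows "ip (f + g) h = ip f h + ip g h"
  using assms unfolding L2_def mem_Collect_eq
  by transfer (simp add: circle_ae_eq_def distrib_right integrable_mult_cnj)

lemma ip_scale_left: "ip (const_fun c * f) h = c * ip f h"
  by transfer (simp add: mult.assoc)

lemma ip_diff_left: "f \<in> L2 \<Longrightarrow> g \<in> L2 \<Longrightarrow> h \<in> L2 \<Longrightarrow> ip (f - g) h = ip f h - ip g h"
  unfolding circle_fun_diff_conv_add by (simp add: ip_add_left L2_scale ip_scale_left)

lemma ip_cnj: "cnj (ip f g) = ip g f"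
  by transfer (simp only: Bochner_Integration.integral_cnj[symmetric] complex_cnj_mult complex_cnj_cnj mult.commute)

lemma ip_mult_left: "ip (u * f) g = ip f (conj_fun u * g)"
  by transfer (simp add: mult_ac)

lemma ip_zero_right: "ip f 0 = 0"
  by transfer simp

lemma ip_zero_left: "ip 0 f = 0"
  by transfer simp

lemma ip_self_eq_zero:
  assumes "f \<in> L2" "ip f f = 0"
  shows "f = 0"
  using assms unfolding L2_def mem_Collect_eq
proof transfer
  fix f :: "complex \<Rightarrow> complex"
  assume f: "circle_ae_eq f f" and int: "integrable circle_measure (\<lambda>z. (cmod (f z))\<^sup>2)"
    and zero: "(LINT z|circle_measure. f z * cnj (f z)) = 0"
  have "(LINT z|circle_measure. complex_of_real ((cmod (f z))\<^sup>2)) = 0"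
    using zero by (simp only: complex_norm_square)
  then have "(LINT z|circle_measure. (cmod (f z))\<^sup>2) = 0"
    by (simp only: integral_complex_of_real of_real_eq_0_iff)
  then have "AE z in circle_measure. (cmod (f z))\<^sup>2 = 0"
    using integral_nonneg_eq_0_iff_AE[OF int] by simp
  then show "circle_ae_eq f (\<lambda>_. 0)"
    using f by (simp add: circle_ae_eq_def)
qed

lemma fourier_coeff_uminus_nat: "fourier_coeff f (- int n) = ip f (z_bar ^ n)"
proof -
  have "fourier_coeff f (- int n) = ip (coord_fun ^ n * f) 1"
  proof (induction n arbitrary: f)
    case 0
    show ?case
      by simp (transfer, simp)
  next
    case (Suc n)
    have "fourier_coeff f (- int (Suc n)) = fourier_coeff (coord_fun * f) (- int n)"
      by transfer (simp add: mult_ac del: of_nat_Suc)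
    then show ?case
      by (simp add: Suc mult_ac)
  qed
  then show ?thesis
    by (simp add: ip_mult_left conj_fun_power)
qed

section \<open>The Hardy space and its orthogonal complement\<close>

lemma H2_iff: "f \<in> H2 \<longleftrightarrow> f \<in> L2 \<and> (\<forall>n. ip f (z_bar ^ Suc n) = 0)"
proof -
  have "n < 0 \<longleftrightarrow> (\<exists>k. n = - int (Suc k))" for n :: int
    by (auto intro: exI[of _ "nat (- n - 1)"])
  then have "(\<forall>n<0. fourier_coeff f n = 0) \<longleftrightarrow> (\<forall>n. fourier_coeff f (- int (Suc n)) = 0)"
    by auto
  then show ?thesis
    unfolding H2_def by (simp only: mem_Collect_eq fourier_coeff_uminus_nat)
qed

lemma H2_L2: "f \<in> H2 \<Longrightarrow> f \<in> L2"
  by (simp add: H2_def)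

lemma H2_add: "f \<in> H2 \<Longrightarrow> g \<in> H2 \<Longrightarrow> f + g \<in> H2"
  by (simp add: H2_iff L2_add ip_add_left L2_z_bar_power del: power_Suc)

lemma H2_scale: "f \<in> H2 \<Longrightarrow> const_fun c * f \<in> H2"
  by (simp add: H2_iff L2_scale ip_scale_left del: power_Suc)

lemma H2_diff: "f \<in> H2 \<Longrightarrow> g \<in> H2 \<Longrightarrow> f - g \<in> H2"
  unfolding circle_fun_diff_conv_add by (intro H2_add H2_scale)

lemma H2_one: "1 \<in> H2"
proof -
  have "ip 1 (z_bar ^ Suc n) = 0" for n
  proof -
    have "ip 1 (z_bar ^ Suc n) = fourier_coeff 1 (- int (Suc n))"
      by (simp only: fourier_coeff_uminus_nat)
    also have "\<dots> = (LINT z|circle_measure. z ^ Suc n)"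
      by transfer (simp del: power_Suc of_nat_Suc)
    finally show ?thesis
      by (simp only: integral_circle_power)
  qed
  then show ?thesis
    by (simp add: H2_iff L2_one del: power_Suc)
qed

lemma H2_zero: "0 \<in> H2"
  using H2_scale[OF H2_one, of 0] by (simp add: const_fun_zero)

lemma ip_one_one: "ip 1 1 = 1"
  by transfer (simp add: measure_circle)

lemma H2_coord_mult:
  assumes "f \<in> H2"
  shows "coord_fun * f \<in> H2"
proof -
  have "ip (coord_fun * f) (z_bar ^ Suc n) = ip f (z_bar ^ Suc (Suc n))" for n
    by (simp add: ip_mult_left)
  then show ?thesis
    using assms by (simp add: H2_iff L2_Linf_mult Linf_coord del: power_Suc)
qed

lemma H2_coord_power_mult: "f \<in> H2 \<Longrightarrow> coord_fun ^ n * f \<in> H2"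
  by (induction n) (auto simp: mult.assoc intro: H2_coord_mult)

lemma H2_z_bar_mult:
  assumes "f \<in> H2" "ip f 1 = 0"
  shows "z_bar * f \<in> H2"
proof -
  have "ip (z_bar * f) (z_bar ^ Suc n) = ip f (z_bar ^ n)" for n
    by (simp add: ip_mult_left conj_fun_conj_fun coord_z_bar_cancel)
  moreover have "ip f (z_bar ^ n) = 0" for n
    using assms by (cases n) (simp_all add: H2_iff del: power_Suc)
  ultimately show ?thesis
    using assms(1) by (simp add: H2_L2 L2_Linf_mult Linf_coord Linf_conj H2_iff del: power_Suc)
qed

abbreviation H2_perp :: "circle_fun set" where
  "H2_perp \<equiv> L2 \<ominus>\<^sub>\<perp> H2"

lemma H2_perp_iff: "f \<in> H2_perp \<longleftrightarrow> f \<in> L2 \<and> (\<forall>h\<in>H2. ip f h = 0)"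
  by (simp add: ominus_def)

lemma H2_perp_add: "f \<in> H2_perp \<Longrightarrow> g \<in> H2_perp \<Longrightarrow> f + g \<in> H2_perp"
  by (simp add: H2_perp_iff L2_add ip_add_left H2_L2)

lemma H2_perp_scale: "f \<in> H2_perp \<Longrightarrow> const_fun c * f \<in> H2_perp"
  by (simp add: H2_perp_iff L2_scale ip_scale_left)

lemma H2_perp_zero: "0 \<in> H2_perp"
  by (simp add: H2_perp_iff L2_zero ip_zero_left)

lemma H2_perp_z_bar_power: "z_bar ^ Suc n \<in> H2_perp"
  unfolding H2_perp_iff
proof (intro conjI ballI)
  fix h assume "h \<in> H2"
  then have "cnj (ip h (z_bar ^ Suc n)) = 0"
    by (simp add: H2_iff del: power_Suc)
  then show "ip (z_bar ^ Suc n) h = 0"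
    by (simp only: ip_cnj)
qed (rule L2_z_bar_power)

text \<open>
  A function with no negative Fourier coefficients belongs to \<open>H\<^sup>2\<close>; if it is also orthogonal to
  \<open>H\<^sup>2\<close>, then it is orthogonal to itself.
\<close>

lemma H2_perp_eq_zero:
  assumes "r \<in> H2_perp" "\<And>n. ip r (z_bar ^ Suc n) = 0"
  shows "r = 0"
proof -
  have "r \<in> H2"
    using assms unfolding H2_perp_iff H2_iff by blast
  then show ?thesis
    using assms(1) by (auto simp: H2_perp_iff intro: ip_self_eq_zero)
qed

text \<open>
  Multiplication by \<open>z\<close> moves the coefficient of \<open>r\<close> at \<open>- 1\<close> to index \<open>0\<close>.  Nothing else enters
  \<open>H\<^sup>2\<close>, so subtracting that constant restores orthogonality.
\<close>

lemma H2_perp_shift: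
  assumes "r \<in> H2_perp"
  shows "coord_fun * r - const_fun (ip r z_bar) \<in> H2_perp"
  unfolding H2_perp_iff
proof (intro conjI ballI)
  have r: "r \<in> L2"
    using assms by (simp add: H2_perp_iff)
  have const: "const_fun c \<in> L2" for c
    using L2_scale[OF L2_one, of c] by simp
  show "coord_fun * r - const_fun (ip r z_bar) \<in> L2"
    by (intro L2_diff L2_Linf_mult Linf_coord r const)
  fix h assume h: "h \<in> H2"
  \<comment> \<open>Only the constant term \<open>c\<close> of \<open>h\<close> leaves \<open>H\<^sup>2\<close> under multiplication by \<open>z_bar\<close>.\<close>
  define c where "c = ip h 1"
  define h' where "h' = h - const_fun c * 1"
  have "h' \<in> H2"
    unfolding h'_def by (intro H2_diff H2_scale h H2_one)
  moreover have "ip h' 1 = 0"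
    unfolding h'_def
    by (simp only: ip_diff_left[OF H2_L2[OF h] L2_scale[OF L2_one] L2_one] ip_scale_left ip_one_one c_def)
      simp
  ultimately have "z_bar * h' \<in> H2"
    by (rule H2_z_bar_mult)
  then have orth: "ip r (z_bar * h') = 0"
    using assms by (simp add: H2_perp_iff)
  have "z_bar * h = z_bar * h' + const_fun c * z_bar"
    by (simp add: h'_def algebra_simps)
  moreover have "ip (z_bar * h' + const_fun c * z_bar) r = ip (z_bar * h') r + c * ip z_bar r"
    using \<open>z_bar * h' \<in> H2\<close> L2_z_bar_power[of 1] r
    by (simp add: ip_add_left H2_L2 L2_scale ip_scale_left)
  ultimately have "ip r (z_bar * h) = ip r (z_bar * h') + cnj c * ip r z_bar"
    by (metis complex_cnj_add complex_cnj_mult ip_cnj)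
  then have "ip (coord_fun * r) h = ip r z_bar * cnj c"
    by (simp add: ip_mult_left orth)
  moreover have "ip (const_fun (ip r z_bar)) h = ip r z_bar * cnj c"
    using ip_scale_left[of "ip r z_bar" 1 h] by (simp add: c_def ip_cnj)
  ultimately show "ip (coord_fun * r - const_fun (ip r z_bar)) h = 0"
    using h r const by (simp add: ip_diff_left L2_Linf_mult Linf_coord H2_L2)
qed

lemma riesz_proj_eqI:
  assumes "g \<in> H2" "f - g \<in> H2_perp"
  shows "riesz_proj f = g"
  unfolding riesz_proj_def orth_proj_def
proof (rule the_equality)
  show "g \<in> H2 \<and> (\<forall>h\<in>H2. ip (f - g) h = 0)"
    using assms by (simp add: H2_perp_iff)
next
  fix k assume k: "k \<in> H2 \<and> (\<forall>h\<in>H2. ip (f - k) h = 0)"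
  have "f - g \<in> L2" and gk: "g - k \<in> H2"
    using assms k by (auto simp: H2_perp_iff intro: H2_diff)
  moreover have "f - k = (f - g) + (g - k)"
    by simp
  ultimately have "ip (f - k) (g - k) = ip (f - g) (g - k) + ip (g - k) (g - k)"
    by (metis H2_L2 ip_add_left)
  then have "ip (g - k) (g - k) = 0"
    using assms(2) k gk by (simp add: H2_perp_iff)
  then show "k = g"
    using ip_self_eq_zero[OF H2_L2[OF gk]] by simp
qed

lemma riesz_proj_H2: "f \<in> H2 \<Longrightarrow> riesz_proj f = f"
  by (rule riesz_proj_eqI) (simp_all add: H2_perp_zero)

lemma riesz_proj_H2_perp: "f \<in> H2_perp \<Longrightarrow> riesz_proj f = 0"
  by (rule riesz_proj_eqI) (simp_all add: H2_zero)

text \<open>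
  As long as the coefficient about to cross index \<open>0\<close> vanishes, multiplication by \<open>z\<close> stays in the
  complement of \<open>H\<^sup>2\<close>; the projection then sees only the coefficient that reaches index \<open>0\<close>.
\<close>

lemma riesz_proj_shift:
  assumes r: "r \<in> H2_perp" and zero: "\<And>k. k < n \<Longrightarrow> ip r (z_bar ^ Suc k) = 0"
  shows "riesz_proj (coord_fun ^ Suc n * r) = const_fun (ip r (z_bar ^ Suc n))"
proof -
  have ip: "ip (coord_fun ^ m * r) z_bar = ip r (z_bar ^ Suc m)" for m
    by (simp only: ip_mult_left conj_fun_power power_Suc2)
  have "m \<le> n \<Longrightarrow> coord_fun ^ m * r \<in> H2_perp" for m
  proof (induction m)
    case (Suc m)
    then have "coord_fun * (coord_fun ^ m * r) - const_fun (ip (coord_fun ^ m * r) z_bar) \<in> H2_perp"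
      by (intro H2_perp_shift) simp
    moreover have "ip (coord_fun ^ m * r) z_bar = 0"
      using zero[of m] Suc.prems ip by simp
    ultimately show ?case
      by (simp add: const_fun_zero mult.assoc)
  qed (simp add: r)
  from H2_perp_shift[OF this[OF order_refl]] show ?thesis
    using H2_scale[OF H2_one] by (intro riesz_proj_eqI) (simp_all only: ip mult.assoc power_Suc mult_1_right)
qed

section \<open>Inner functions\<close>

lemma inner_Linf: "inner_fun \<theta> \<Longrightarrow> \<theta> \<in> Linf"
  unfolding Linf_def mem_Collect_eq
  by transfer (auto intro!: exI[of _ 1] elim: eventually_mono)

lemma inner_unimodular: "inner_fun \<theta> \<Longrightarrow> conj_fun \<theta> * \<theta> = 1"
proof transfer
  fix f :: "complex \<Rightarrow> complex"
  assume f: "circle_ae_eq f f"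
    and inner: "(\<exists>F. F holomorphic_on ball 0 1 \<and> bounded (F ` ball 0 1) \<and>
            (AE z in circle_measure. ((\<lambda>r. F (of_real r * z)) \<longlongrightarrow> f z) (at_left 1))) \<and>
          (AE z in circle_measure. cmod (f z) = 1)"
  have "cnj w * w = 1" if "cmod w = 1" for w
    using complex_norm_square[of w] that by (simp add: mult.commute)
  then have "AE z in circle_measure. cnj (f z) * f z = 1"
    using inner by (auto elim: eventually_mono)
  then show "circle_ae_eq (\<lambda>z. cnj (f z) * f z) (\<lambda>_. 1)"
    using f by (auto simp: circle_ae_eq_def intro!: borel_measurable_times borel_measurable_cnj_comp)
qed

lemma inner_cancel:
  assumes "inner_fun \<theta>"
  shows "\<theta> * (conj_fun \<theta> * f) = f" "conj_fun \<theta> * (\<theta> * f) = f"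
  using inner_unimodular[OF assms] by (metis mult.assoc mult.commute mult_1_left)+

text \<open>
  On each circle of radius \<open>r < 1\<close> the holomorphic function is a uniformly convergent power
  series, so its product with \<open>h\<close> has only those Fourier coefficients that come from
  nonnegative powers of \<open>z\<close>; bounded convergence carries this over to the radial limit.
\<close>

lemma bounded_analytic_mult_moments:
  fixes f h :: "complex \<Rightarrow> complex"
  assumes F: "F holomorphic_on ball 0 1" "bounded (F ` ball 0 1)"
    and lim: "AE z in circle_measure. ((\<lambda>r. F (of_real r * z)) \<longlongrightarrow> f z) (at_left 1)"
    and f: "f \<in> borel_measurable circle_measure"
    and h: "integrable circle_measure h"
    and moments: "\<And>k. (LINT z|circle_measure. z ^ Suc k * h z) = 0"
  shows "(LINT z|circle_measure. z ^ Suc n * (f z * h z)) = 0"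
proof -
  have in_ball: "of_real r * z \<in> ball 0 1" if "0 \<le> r" "r < 1" "z \<in> sphere 0 1" for r and z :: complex
    using that by (simp add: norm_mult)
  have cont: "continuous_on (sphere 0 1) (\<lambda>z. F (of_real r * z))" if "0 \<le> r" "r < 1" for r
    using that in_ball
    by (intro continuous_on_compose2[OF holomorphic_on_imp_continuous_on[OF F(1)]] continuous_intros) auto
  have int: "integrable circle_measure (\<lambda>z. z ^ m * h z)" for m
    by (intro integrable_mult_continuous_circle h continuous_intros)
  have radial: "(LINT z|circle_measure. z ^ Suc n * (F (of_real r * z) * h z)) = 0"
    if r: "0 \<le> r" "r < 1" for r
  proof -
    define a where "a k = (deriv ^^ k) F 0 / fact k * of_real r ^ k" for k
    \<comment> \<open>\<open>a k\<close> are the Taylor coefficients of \<open>z \<mapsto> F (r z)\<close>, and \<open>s k\<close> the terms of the resulting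
      expansion of the integrand.\<close>
    define s where "s k z = a k * (z ^ Suc (n + k) * h z)" for k z
    \<comment> \<open>Convergence at a radius \<open>R > r\<close> gives absolute convergence at \<open>r\<close>.\<close>
    obtain R where R: "r < R" "R < 1"
      using dense r by blast
    have "(\<lambda>k. (deriv ^^ k) F 0 / fact k * (of_real R - 0) ^ k) sums F (of_real R)"
      using r R by (intro holomorphic_power_series[OF F(1)]) simp
    then have "summable (\<lambda>k. (deriv ^^ k) F 0 / fact k * of_real R ^ k)"
      by (simp add: sums_iff)
    then have "summable (\<lambda>k. cmod ((deriv ^^ k) F 0 / fact k * of_real r ^ k))"
      by (rule powser_insidea) (use r R in simp)
    then have abs: "summable (\<lambda>k. cmod (a k))"
      by (simp add: a_def)
    have sums: "(\<lambda>k. s k z) sums (z ^ Suc n * (F (of_real r * z) * h z))" if "z \<in> sphere 0 1" for z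
    proof -
      have "(\<lambda>k. (deriv ^^ k) F 0 / fact k * (of_real r * z - 0) ^ k) sums F (of_real r * z)"
        by (intro holomorphic_power_series[OF F(1)] in_ball r that)
      then have "(\<lambda>k. a k * z ^ k) sums F (of_real r * z)"
        by (simp add: a_def power_mult_distrib mult.assoc)
      then have "(\<lambda>k. (z ^ Suc n * h z) * (a k * z ^ k)) sums ((z ^ Suc n * h z) * F (of_real r * z))"
        by (rule sums_mult)
      then show ?thesis
        by (simp add: s_def power_add mult_ac)
    qed
    have norm_s: "norm (s k z) = cmod (a k) * cmod (h z)" if "z \<in> space circle_measure" for k z
      using that by (simp add: s_def norm_mult norm_power)
    have "(\<lambda>k. LINT z|circle_measure. s k z) sums (LINT z|circle_measure. (\<Sum>k. s k z))"
    proof (rule sums_integral)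
      show "integrable circle_measure (s k)" for k
        unfolding s_def by (intro integrable_mult_right int)
      show "AE z in circle_measure. summable (\<lambda>k. norm (s k z))"
        using abs by (intro AE_I2) (simp only: norm_s summable_mult2)
      have "(LINT z|circle_measure. norm (s k z)) = cmod (a k) * (LINT z|circle_measure. cmod (h z))" for k
        by (subst Bochner_Integration.integral_cong[OF refl norm_s]) simp_all
      then show "summable (\<lambda>k. LINT z|circle_measure. norm (s k z))"
        using abs by (simp only: summable_mult2)
    qed
    moreover have "(LINT z|circle_measure. s k z) = 0" for k
      unfolding s_def using moments[of "n + k"] by (simp del: power_Suc)
    ultimately have "(LINT z|circle_measure. (\<Sum>k. s k z)) = 0"
      by (simp add: sums_iff)
    moreover have "(LINT z|circle_measure. (\<Sum>k. s k z)) =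
        (LINT z|circle_measure. z ^ Suc n * (F (of_real r * z) * h z))"
      using sums by (intro Bochner_Integration.integral_cong refl) (simp add: sums_iff)
    ultimately show ?thesis
      by simp
  qed
  define \<rho> where "\<rho> j = 1 - inverse (real (Suc j))" for j
  have \<rho>: "0 \<le> \<rho> j" "\<rho> j < 1" for j
    by (simp_all add: \<rho>_def inverse_le_1_iff)
  have "\<rho> \<longlonglongrightarrow> 1 - 0"
    unfolding \<rho>_def by (intro tendsto_diff tendsto_const LIMSEQ_inverse_real_of_nat)
  then have \<rho>_lim: "filterlim \<rho> (at_left 1) sequentially"
    using \<rho>(2) less_imp_neq[OF \<rho>(2)] by (auto simp: filterlim_at intro!: always_eventually)
  obtain C where C: "\<And>w. w \<in> ball 0 1 \<Longrightarrow> cmod (F w) \<le> C"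
    using F(2) unfolding bounded_iff by blast
  have "(\<lambda>j. LINT z|circle_measure. z ^ Suc n * (F (of_real (\<rho> j) * z) * h z))
      \<longlonglongrightarrow> (LINT z|circle_measure. z ^ Suc n * (f z * h z))"
  proof (rule integral_dominated_convergence)
    have pow: "(\<lambda>z. z ^ Suc n) \<in> borel_measurable circle_measure"
      by (intro measurable_circle_continuous continuous_intros)
    show "(\<lambda>z. z ^ Suc n * (f z * h z)) \<in> borel_measurable circle_measure"
      by (intro borel_measurable_times pow f borel_measurable_integrable h)
    show "(\<lambda>z. z ^ Suc n * (F (of_real (\<rho> j) * z) * h z)) \<in> borel_measurable circle_measure" for j
      by (intro borel_measurable_times pow measurable_circle_continuous cont \<rho> borel_measurable_integrable h)
    show "integrable circle_measure (\<lambda>z. C * cmod (h z))"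
      using h by simp
    show "AE z in circle_measure.
        (\<lambda>j. z ^ Suc n * (F (of_real (\<rho> j) * z) * h z)) \<longlonglongrightarrow> z ^ Suc n * (f z * h z)"
      using lim
    proof eventually_elim
      case (elim z)
      then show ?case
        by (intro tendsto_intros filterlim_compose[OF _ \<rho>_lim])
    qed
    show "AE z in circle_measure. cmod (z ^ Suc n * (F (of_real (\<rho> j) * z) * h z)) \<le> C * cmod (h z)" for j
    proof (rule AE_I2)
      fix z assume "z \<in> space circle_measure"
      then have "z \<in> sphere 0 1"
        by simp
      then have "cmod (F (of_real (\<rho> j) * z)) \<le> C" "cmod z = 1"
        using C in_ball \<rho> by auto
      then show "cmod (z ^ Suc n * (F (of_real (\<rho> j) * z) * h z)) \<le> C * cmod (h z)"
        by (simp add: norm_mult norm_power mult_right_mono del: power_Suc)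
    qed
  qed
  then show ?thesis
    using radial[OF \<rho>] by (simp add: LIMSEQ_const_iff del: power_Suc)
qed

lemma inner_mult_H2:
  assumes \<theta>: "inner_fun \<theta>" and h: "h \<in> H2"
  shows "\<theta> * h \<in> H2"
proof -
  have "fourier_coeff (\<theta> * h) (- int (Suc n)) = 0" for n
  proof -
    have "square_integrable h" and "\<forall>k. fourier_coeff h (- int (Suc k)) = 0"
      using h by (auto simp: H2_def L2_def)
    with \<theta> show ?thesis
    proof (transfer fixing: n)
      fix f h :: "complex \<Rightarrow> complex"
      assume "circle_ae_eq f f" "circle_ae_eq h h"
        and inner: "(\<exists>F. F holomorphic_on ball 0 1 \<and> bounded (F ` ball 0 1) \<and>
            (AE z in circle_measure. ((\<lambda>r. F (of_real r * z)) \<longlongrightarrow> f z) (at_left 1))) \<and>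
          (AE z in circle_measure. cmod (f z) = 1)"
        and h: "integrable circle_measure (\<lambda>z. (cmod (h z))\<^sup>2)"
        and moments: "\<forall>k. (LINT z|circle_measure. h z * z powi (- (- int (Suc k)))) = 0"
      then have meas: "f \<in> borel_measurable circle_measure" "h \<in> borel_measurable circle_measure"
        by (auto simp: circle_ae_eq_def)
      have "integrable circle_measure (\<lambda>z. h z * cnj 1)"
        by (rule integrable_mult_cnj) (use meas h in auto)
      moreover have "(LINT z|circle_measure. z ^ Suc k * h z) = 0" for k
        using moments[rule_format, of k]
        by (simp only: minus_minus power_int_of_nat mult.commute)
      moreover obtain F where "F holomorphic_on ball 0 1" "bounded (F ` ball 0 1)"
        "AE z in circle_measure. ((\<lambda>r. F (of_real r * z)) \<longlongrightarrow> f z) (at_left 1)"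
        using inner by blast
      ultimately have "(LINT z|circle_measure. z ^ Suc n * (f z * h z)) = 0"
        using meas by (intro bounded_analytic_mult_moments) auto
      then show "(LINT z|circle_measure. f z * h z * z powi (- (- int (Suc n)))) = 0"
        by (simp only: minus_minus power_int_of_nat mult.commute)
    qed
  qed
  then show ?thesis
    using h \<theta> by (simp add: H2_iff fourier_coeff_uminus_nat L2_Linf_mult inner_Linf del: power_Suc of_nat_Suc)
qed

lemma conj_inner_mult_H2_perp:
  assumes "inner_fun \<theta>" "r \<in> H2_perp"
  shows "conj_fun \<theta> * r \<in> H2_perp"
  using assms
  by (simp add: H2_perp_iff L2_Linf_mult Linf_conj inner_Linf ip_mult_left conj_fun_conj_fun inner_mult_H2)

lemma model_space_conj_inner_mult:
  assumes "inner_fun \<theta>" "f \<in> model_space \<theta>"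
  shows "conj_fun \<theta> * f \<in> H2_perp"
  using assms
  by (simp add: model_space_def ominus_def L2_Linf_mult Linf_conj inner_Linf ip_mult_left
      conj_fun_conj_fun H2_L2)

text \<open>
  If \<open>\<theta>\<close> vanishes at the origin, then so does \<open>\<theta> h\<close> for every \<open>h\<close> in \<open>H\<^sup>2\<close>.  This is the
  form in which \<open>1\<close> belongs to the model space.
\<close>

lemma conj_inner_H2_perp:
  assumes \<theta>: "inner_fun \<theta>" "fourier_coeff \<theta> 0 = 0"
  shows "conj_fun \<theta> \<in> H2_perp"
proof -
  have \<theta>_H2: "\<theta> \<in> H2"
    using inner_mult_H2[OF \<theta>(1) H2_one] by simp
  have \<theta>0: "ip \<theta> 1 = 0"
    using \<theta>(2) fourier_coeff_uminus_nat[of \<theta> 0] by simp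
  have "ip (\<theta> * h) 1 = 0" if h: "h \<in> H2" for h
  proof -
    define h' where "h' = h - const_fun (ip h 1) * 1"
    have h': "h' \<in> H2"
      unfolding h'_def by (intro H2_diff H2_scale h H2_one)
    have "ip h' 1 = 0"
      unfolding h'_def
      by (simp only: ip_diff_left[OF H2_L2[OF h] L2_scale[OF L2_one] L2_one] ip_scale_left ip_one_one)
        simp
    with h' have "\<theta> * (z_bar * h') \<in> H2"
      by (intro inner_mult_H2[OF \<theta>(1)] H2_z_bar_mult)
    then have "ip (\<theta> * (z_bar * h')) (z_bar ^ Suc 0) = 0"
      by (simp only: H2_iff)
    then have "ip (z_bar * (\<theta> * h')) (z_bar * 1) = 0"
      by (simp add: mult.left_commute)
    then have "ip (\<theta> * h') 1 = 0"
      by (simp only: ip_mult_left conj_fun_conj_fun coord_z_bar_cancel)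
    moreover have "\<theta> * h = \<theta> * h' + const_fun (ip h 1) * \<theta>"
      by (simp add: h'_def algebra_simps)
    ultimately show ?thesis
      using \<theta>_H2 h' \<theta>
      by (simp add: ip_add_left ip_scale_left \<theta>0 H2_L2 L2_scale L2_one inner_mult_H2)
  qed
  then have "ip 1 (\<theta> * h) = 0" if "h \<in> H2" for h
    using that by (metis complex_cnj_zero ip_cnj)
  then show ?thesis
    using \<theta>_H2 ip_mult_left[of "conj_fun \<theta>" 1]
    by (simp add: H2_perp_iff L2_conj H2_L2 conj_fun_conj_fun)
qed

section \<open>Operators on the complement of the model space\<close>

lemma model_perp_proj_H2: "f \<in> H2 \<Longrightarrow> model_perp_proj \<theta> f = \<theta> * riesz_proj (conj_fun \<theta> * f)"
  by (simp add: model_perp_proj_def riesz_coproj_def riesz_proj_H2)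

lemma model_perp_proj_H2_perp:
  assumes "inner_fun \<theta>" "f \<in> H2_perp"
  shows "model_perp_proj \<theta> f = f"
  using assms
  by (simp add: model_perp_proj_def riesz_coproj_def riesz_proj_H2_perp conj_inner_mult_H2_perp)

lemma H2_perp_subset_model_perp: "H2_perp \<subseteq> model_perp \<theta>"
  by (auto simp: model_perp_def model_space_def ominus_def)

lemma adjoint_on_model_perp_zero: "adjoint_on (model_perp \<theta>) A 0 = 0"
  unfolding adjoint_on_def
proof (rule the_equality)
  show "0 \<in> model_perp \<theta> \<and> (\<forall>h\<in>model_perp \<theta>. ip (A h) 0 = ip h 0)"
    using H2_perp_zero H2_perp_subset_model_perp by (auto simp: ip_zero_right)
next
  fix k assume "k \<in> model_perp \<theta> \<and> (\<forall>h\<in>model_perp \<theta>. ip (A h) 0 = ip h k)"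
  then have "k \<in> L2" "ip k k = 0"
    by (auto simp: model_perp_def ominus_def ip_zero_right)
  then show "k = 0"
    by (rule ip_self_eq_zero)
qed

lemma dual_trunc_Hankel_zero:
  assumes "inner_fun \<theta>"
  shows "dual_trunc_Hankel \<theta> 0 h = 0" "dual_trunc_Hankel \<theta> \<phi> 0 = 0"
  using assms by (simp_all add: dual_trunc_Hankel_def flip_zero model_perp_proj_H2_perp H2_perp_zero)

lemma compressed_shift_z_bar:
  assumes "inner_fun \<theta>" "fourier_coeff \<theta> 0 = 0"
  shows "compressed_shift \<theta> z_bar = 0"
proof -
  have "coord_fun * z_bar = 1"
    using z_bar_coord by (simp add: mult.commute)
  then show ?thesis
    using assms
    by (simp add: compressed_shift_def model_perp_proj_H2 H2_one riesz_proj_H2_perp conj_inner_H2_perp)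
qed

lemma compressed_shift_z_bar_power:
  assumes "inner_fun \<theta>"
  shows "compressed_shift \<theta> (z_bar ^ Suc (Suc n)) = z_bar ^ Suc n"
proof -
  have "coord_fun * z_bar ^ Suc (Suc n) = z_bar ^ Suc n"
    by (simp add: coord_z_bar_cancel)
  then show ?thesis
    using model_perp_proj_H2_perp[OF assms H2_perp_z_bar_power] by (simp only: compressed_shift_def)
qed

text \<open>
  The identity forces the operator to kill \<open>z_bar\<close>, because the compressed shift does; since the
  compressed shift lowers the powers of \<open>z_bar\<close>, all of them are killed.
\<close>

lemma Toeplitz_identity_vanishes:
  assumes \<theta>: "inner_fun \<theta>" "fourier_coeff \<theta> 0 = 0"
    and T: "\<And>h. h \<in> model_perp \<theta> \<Longrightarrow>
      adjoint_on (model_perp \<theta>) (compressed_shift \<theta>) (T (compressed_shift \<theta> h)) = T h"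
    and T0: "T 0 = 0"
  shows "T (z_bar ^ Suc n) = 0"
proof (induction n)
  have mem: "z_bar ^ Suc m \<in> model_perp \<theta>" for m
    using H2_perp_z_bar_power H2_perp_subset_model_perp by blast
  case 0
  show ?case
    using T[OF mem[of 0]] by (simp add: compressed_shift_z_bar[OF \<theta>] T0 adjoint_on_model_perp_zero)
next
  case (Suc n)
  have "z_bar ^ Suc (Suc n) \<in> model_perp \<theta>"
    using H2_perp_z_bar_power H2_perp_subset_model_perp by blast
  from T[OF this] Suc show ?case
    by (simp only: compressed_shift_z_bar_power[OF \<theta>(1)] adjoint_on_model_perp_zero)
qed

section \<open>Dual truncated Hankel operators with symbols in the space Z\<close>

lemma flip_eq_conj_fun: "star_fun \<theta> = \<theta> \<Longrightarrow> flip \<theta> = conj_fun \<theta>"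
  by (metis conj_fun_conj_fun star_fun_def)

text \<open>
  Write \<open>\<phi> = d z + J f\<close> with \<open>f\<close> in the model space.  As \<open>J \<theta>\<close> is the conjugate of \<open>\<theta>\<close>,
  the function \<open>J(\<phi> \<theta>)\<close> is \<open>d z_bar + f\<close> times this conjugate.  The first summand gives
  something orthogonal to \<open>H\<^sup>2\<close> because \<open>z_bar\<close> is and \<open>\<theta> H\<^sup>2 \<subseteq> H\<^sup>2\<close>, the second because \<open>f\<close>
  is orthogonal to \<open>\<theta> H\<^sup>2\<close>.  On the other hand \<open>J \<phi> = d z_bar + f\<close> itself fails to be analytic
  only through the term \<open>d z_bar\<close>, which one factor \<open>z\<close> cancels.
\<close>

lemma Z_space_symbol:
  assumes \<theta>: "inner_fun \<theta>" "star_fun \<theta> = \<theta>" "fourier_coeff \<theta> 0 = 0"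
    and \<phi>: "\<phi> \<in> Z_space \<theta>"
  shows "flip (\<phi> * \<theta>) \<in> H2_perp" and "coord_fun ^ Suc n * flip \<phi> \<in> H2"
proof -
  obtain d f where f: "f \<in> model_space \<theta>" and \<phi>_eq: "\<phi> = const_fun d * coord_fun + flip f"
    using \<phi> \<theta>(3) by (auto simp: Z_space_def const_fun_zero circle_fun_divide_one)
  have flip: "flip \<phi> = const_fun d * z_bar + f"
    by (simp add: \<phi>_eq flip_add flip_mult flip_const flip_coord flip_flip)
  have "flip (\<phi> * \<theta>) = const_fun d * (conj_fun \<theta> * z_bar) + conj_fun \<theta> * f"
    by (simp add: flip_mult flip flip_eq_conj_fun[OF \<theta>(2)] algebra_simps)
  also have "\<dots> \<in> H2_perp"
    using H2_perp_z_bar_power[of 0] \<theta>(1) f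
    by (intro H2_perp_add H2_perp_scale conj_inner_mult_H2_perp model_space_conj_inner_mult) auto
  finally show "flip (\<phi> * \<theta>) \<in> H2_perp" .
  have "f \<in> H2"
    using f by (simp add: model_space_def ominus_def)
  have "coord_fun ^ Suc n * flip \<phi> =
      const_fun d * (coord_fun ^ n * (coord_fun * (z_bar * 1))) + coord_fun ^ Suc n * f"
    by (simp add: flip algebra_simps)
  also have "\<dots> = const_fun d * (coord_fun ^ n * 1) + coord_fun ^ Suc n * f"
    by (simp only: coord_z_bar_cancel)
  also have "\<dots> \<in> H2"
    by (intro H2_add H2_scale H2_coord_power_mult H2_one \<open>f \<in> H2\<close>)
  finally show "coord_fun ^ Suc n * flip \<phi> \<in> H2" .
qed

lemma dual_trunc_Hankel_z_bar_power:
  assumes \<theta>: "inner_fun \<theta>" "star_fun \<theta> = \<theta>" "fourier_coeff \<theta> 0 = 0"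
    and \<psi>: "\<psi> \<in> Z_space \<theta>"
  shows "dual_trunc_Hankel \<theta> \<psi> (z_bar ^ Suc n) =
      \<theta> * riesz_proj (coord_fun ^ Suc n * flip (\<psi> * \<theta>))"
proof -
  have "flip (\<psi> * z_bar ^ Suc n) = coord_fun ^ Suc n * flip \<psi>"
    by (simp add: flip_mult flip_power flip_z_bar algebra_simps)
  moreover have "conj_fun \<theta> * (coord_fun ^ Suc n * flip \<psi>) = coord_fun ^ Suc n * flip (\<psi> * \<theta>)"
    by (simp add: flip_mult flip_eq_conj_fun[OF \<theta>(2)] algebra_simps)
  ultimately show ?thesis
    using Z_space_symbol(2)[OF \<theta> \<psi>, of n]
    by (simp only: dual_trunc_Hankel_def model_perp_proj_H2)
qed

lemma dual_trunc_Hankel_inner: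
  assumes "inner_fun \<theta>" "star_fun \<theta> = \<theta>" "fourier_coeff \<theta> 0 = 0" "\<phi> \<in> Z_space \<theta>"
  shows "dual_trunc_Hankel \<theta> \<phi> (\<theta> * const_fun c) = const_fun c * flip (\<phi> * \<theta>)"
proof -
  have "flip (\<phi> * (\<theta> * const_fun c)) = const_fun c * flip (\<phi> * \<theta>)"
    by (simp add: flip_mult flip_const mult_ac)
  then show ?thesis
    using assms Z_space_symbol(1)[OF assms]
    by (simp add: dual_trunc_Hankel_def model_perp_proj_H2_perp H2_perp_scale)
qed

lemma flip_mult_inner_eq_zero:
  assumes "inner_fun \<theta>" "flip (\<phi> * \<theta>) = 0"
  shows "\<phi> = 0"
proof -
  have "\<phi> * \<theta> = 0"
    using assms(2) by (metis flip_flip flip_zero)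
  then have "conj_fun \<theta> * (\<theta> * \<phi>) = 0"
    by (simp add: mult.commute)
  then show ?thesis
    by (simp add: inner_cancel[OF assms(1)])
qed

text \<open>
  If \<open>- n - 1\<close> is the largest index at which the Fourier coefficient \<open>c\<close> of \<open>J(\<psi> \<theta>)\<close> is
  nonzero, then \<open>z_bar ^ Suc n\<close> is mapped to \<open>c \<theta>\<close> and then to \<open>c J(\<phi> \<theta>)\<close>.
\<close>

lemma dual_trunc_Hankel_product_nonzero:
  assumes \<theta>: "inner_fun \<theta>" "star_fun \<theta> = \<theta>" "fourier_coeff \<theta> 0 = 0"
    and \<phi>: "\<phi> \<in> Z_space \<theta>" "\<phi> \<noteq> 0" and \<psi>: "\<psi> \<in> Z_space \<theta>" "\<psi> \<noteq> 0"
  obtains n where "dual_trunc_Hankel \<theta> \<phi> (dual_trunc_Hankel \<theta> \<psi> (z_bar ^ Suc n)) \<noteq> 0"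
proof -
  define w where "w = flip (\<psi> * \<theta>)"
  have w: "w \<in> H2_perp"
    unfolding w_def by (rule Z_space_symbol(1)[OF \<theta> \<psi>(1)])
  have "w \<noteq> 0"
    using flip_mult_inner_eq_zero[OF \<theta>(1)] \<psi>(2) by (auto simp: w_def)
  then have ex: "\<exists>n. ip w (z_bar ^ Suc n) \<noteq> 0"
    using H2_perp_eq_zero[OF w] by blast
  define n where "n = (LEAST n. ip w (z_bar ^ Suc n) \<noteq> 0)"
  define c where "c = ip w (z_bar ^ Suc n)"
  have c: "c \<noteq> 0"
    unfolding c_def n_def by (rule LeastI_ex[OF ex])
  have "ip w (z_bar ^ Suc k) = 0" if "k < n" for k
    using not_less_Least[of k "\<lambda>n. ip w (z_bar ^ Suc n) \<noteq> 0"] that unfolding n_def by blast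
  then have "riesz_proj (coord_fun ^ Suc n * w) = const_fun c"
    unfolding c_def by (rule riesz_proj_shift[OF w])
  then have "dual_trunc_Hankel \<theta> \<psi> (z_bar ^ Suc n) = \<theta> * const_fun c"
    using dual_trunc_Hankel_z_bar_power[OF \<theta> \<psi>(1), of n] by (simp only: w_def)
  then have eq: "dual_trunc_Hankel \<theta> \<phi> (dual_trunc_Hankel \<theta> \<psi> (z_bar ^ Suc n)) =
      const_fun c * flip (\<phi> * \<theta>)"
    by (simp only: dual_trunc_Hankel_inner[OF \<theta> \<phi>(1)])
  have "const_fun (1 / c) * (const_fun c * flip (\<phi> * \<theta>)) = flip (\<phi> * \<theta>)"
    using c by (simp add: mult.assoc[symmetric] const_fun_mult[symmetric] const_fun_one)
  then have "const_fun c * flip (\<phi> * \<theta>) \<noteq> 0"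
    using flip_mult_inner_eq_zero[OF \<theta>(1), of \<phi>] \<phi>(2) by auto
  with eq show ?thesis
    by (intro that[of n]) simp
qed

theorem theorem4p7:
  fixes \<theta> \<phi> \<psi> :: circle_fun
  assumes "inner_fun \<theta>" and "star_fun \<theta> = \<theta>" and "fourier_coeff \<theta> 0 = 0"
    and "\<phi> \<in> Linf \<inter> Z_space \<theta>" and "\<psi> \<in> Linf \<inter> Z_space \<theta>"
  shows "(\<forall>h \<in> model_perp \<theta>.
            adjoint_on (model_perp \<theta>) (compressed_shift \<theta>)
              (dual_trunc_Hankel \<theta> \<phi> (dual_trunc_Hankel \<theta> \<psi> (compressed_shift \<theta> h)))
            = dual_trunc_Hankel \<theta> \<phi> (dual_trunc_Hankel \<theta> \<psi> h))
         \<longleftrightarrow> \<phi> = 0 \<or> \<psi> = 0"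
    (is "?identity \<longleftrightarrow> _")
proof
  assume ?identity
  then have "dual_trunc_Hankel \<theta> \<phi> (dual_trunc_Hankel \<theta> \<psi> (z_bar ^ Suc n)) = 0" for n
    using Toeplitz_identity_vanishes[OF assms(1,3),
        of "\<lambda>h. dual_trunc_Hankel \<theta> \<phi> (dual_trunc_Hankel \<theta> \<psi> h)"]
      dual_trunc_Hankel_zero[OF assms(1)]
    by simp
  then show "\<phi> = 0 \<or> \<psi> = 0"
    using dual_trunc_Hankel_product_nonzero[OF assms(1-3), of \<phi> \<psi>] assms(4,5) by blast
next
  assume "\<phi> = 0 \<or> \<psi> = 0"
  then have "dual_trunc_Hankel \<theta> \<phi> (dual_trunc_Hankel \<theta> \<psi> h) = 0" for h
    using dual_trunc_Hankel_zero[OF assms(1)] by auto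
  then show ?identity
    by (simp add: adjoint_on_model_perp_zero)
qed

end
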